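(* Let $(\mathcal{X},\mathbf{h})$ be a representable polymatroid, and for $0\le\epsilon\le\mathbf{h}(\mathcal{X})$ define $\mathbf{g}_\epsilon(\mathcal{A})=\min\big(\mathbf{h}(\mathcal{A}),\ \mathbf{h}(\mathcal{X})-\epsilon\big)$ for all $\mathcal{A}\subseteq\mathcal{X}$. Then $(\mathcal{X},\mathbf{g}_\epsilon)$ is almost representable for every $0\le\epsilon\le\mathbf{h}(\mathcal{X})$. Moreover, if $\epsilon\in\mathbb{Z}$ then $(\mathcal{X},\mathbf{g}_\epsilon)$ is representable.
   Context: A polymatroid $(\mathcal{X},\mathbf{h})$ is a finite ground set $\mathcal{X}$ with a function $\mathbf{h}:2^{\mathcal{X}}\to\mathbb{R}_{\ge0}$ satisfying $\mathbf{h}(\emptyset)=0$, monotonicity, and submodularity. Let $\mathcal{X}=\{X_1,\dots,X_n\}$ and $X_\alpha=\{X_i:i\in\alpha\}$ for $\alpha\subseteq\{1,\dots,n\}$. The polymatroid is $q$-representable if there exist subspaces $V_1,\dots,V_n$ of a vector space over the finite field $\mathbb{F}_q$ with $\mathbf{h}(X_\alpha)=\dim\langle V_i: i\in\alpha\rangle$ for all $\alpha$ (where $\langle\cdot\rangle$ denotes the span); it is representable if it is $q$-representable for some $q$. Viewing rank functions as vectors in $\mathbb{R}^{2^{|\mathcal{X}|}}$, $\mathbf{h}$ is almost representable if there exist representable rank functions $\mathbf{g}_i$ on $\mathcal{X}$ and positive reals $c_i$ with $\mathbf{h}=\lim_{i\to\infty}c_i\mathbf{g}_i$. *)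

theory Defs
  imports "HOL-Algebra.Ring" "HOL-Algebra.Module" Complex_Main
begin

definition polymatroid :: "'e set \<Rightarrow> ('e set \<Rightarrow> real) \<Rightarrow> bool" where
  "polymatroid E h \<longleftrightarrow> finite E \<and> h {} = 0 \<and>
     (\<forall>A. A \<subseteq> E \<longrightarrow> h A \<ge> 0) \<and>
     (\<forall>A B. A \<subseteq> B \<and> B \<subseteq> E \<longrightarrow> h A \<le> h B) \<and>
     (\<forall>A B. A \<subseteq> E \<and> B \<subseteq> E \<longrightarrow> h (A \<union> B) + h (A \<inter> B) \<le> h A + h B)"

definition fvec :: "('a, 'b) ring_scheme \<Rightarrow> nat \<Rightarrow> (nat \<Rightarrow> 'a) set" where
  "fvec R d = {v. (\<forall>i<d. v i \<in> carrier R) \<and> (\<forall>i\<ge>d. v i = \<zero>\<^bsub>R\<^esub>)}"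

definition fzero :: "('a, 'b) ring_scheme \<Rightarrow> nat \<Rightarrow> 'a" where
  "fzero R = (\<lambda>i. \<zero>\<^bsub>R\<^esub>)"

definition fadd :: "('a, 'b) ring_scheme \<Rightarrow> (nat \<Rightarrow> 'a) \<Rightarrow> (nat \<Rightarrow> 'a) \<Rightarrow> nat \<Rightarrow> 'a" where
  "fadd R v w = (\<lambda>i. v i \<oplus>\<^bsub>R\<^esub> w i)"

definition fsmult :: "('a, 'b) ring_scheme \<Rightarrow> 'a \<Rightarrow> (nat \<Rightarrow> 'a) \<Rightarrow> nat \<Rightarrow> 'a" where
  "fsmult R c v = (\<lambda>i. c \<otimes>\<^bsub>R\<^esub> v i)"

inductive_set fspan :: "('a, 'b) ring_scheme \<Rightarrow> nat \<Rightarrow> (nat \<Rightarrow> 'a) set \<Rightarrow> (nat \<Rightarrow> 'a) set"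
  for R d S where
  span_zero: "fzero R \<in> fspan R d S"
| span_base: "v \<in> S \<Longrightarrow> v \<in> fspan R d S"
| span_add: "v \<in> fspan R d S \<Longrightarrow> w \<in> fspan R d S \<Longrightarrow> fadd R v w \<in> fspan R d S"
| span_smult: "c \<in> carrier R \<Longrightarrow> v \<in> fspan R d S \<Longrightarrow> fsmult R c v \<in> fspan R d S"

definition fsubspace :: "('a, 'b) ring_scheme \<Rightarrow> nat \<Rightarrow> (nat \<Rightarrow> 'a) set \<Rightarrow> bool" where
  "fsubspace R d W \<longleftrightarrow> W \<subseteq> fvec R d \<and> fspan R d W = W"

definition fdim :: "('a, 'b) ring_scheme \<Rightarrow> nat \<Rightarrow> (nat \<Rightarrow> 'a) set \<Rightarrow> nat" where
  "fdim R d W = (LEAST n. \<exists>B. B \<subseteq> W \<and> finite B \<and> card B = n \<and> fspan R d B = W)"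

text \<open>q-representable: subspaces V_e of F_q^d (every finite-dimensional F_q-space is
  isomorphic to some F_q^d; we take the field on a carrier of natural numbers, which
  loses no generality since every finite field is isomorphic to one such).\<close>
definition q_representable :: "nat \<Rightarrow> 'e set \<Rightarrow> ('e set \<Rightarrow> real) \<Rightarrow> bool" where
  "q_representable q E h \<longleftrightarrow>
     (\<exists>(R :: nat ring) d (V :: 'e \<Rightarrow> (nat \<Rightarrow> nat) set).
        field R \<and> finite (carrier R) \<and> card (carrier R) = q \<and>
        (\<forall>e\<in>E. fsubspace R d (V e)) \<and>
        (\<forall>A. A \<subseteq> E \<longrightarrow> h A = real (fdim R d (fspan R d (\<Union>e\<in>A. V e)))))"

definition representable :: "'e set \<Rightarrow> ('e set \<Rightarrow> real) \<Rightarrow> bool" where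
  "representable E h \<longleftrightarrow> (\<exists>q. q_representable q E h)"

definition almost_representable :: "'e set \<Rightarrow> ('e set \<Rightarrow> real) \<Rightarrow> bool" where
  "almost_representable E h \<longleftrightarrow>
     (\<exists>(g :: nat \<Rightarrow> 'e set \<Rightarrow> real) (c :: nat \<Rightarrow> real).
        (\<forall>i. representable E (g i)) \<and> (\<forall>i. c i > 0) \<and>
        (\<forall>A. A \<subseteq> E \<longrightarrow> (\<lambda>i. c i * g i A) \<longlonglongrightarrow> h A))"

end

theory Submission
  imports Defs "HOL-Algebra.Weak_Morphisms" "HOL-Library.Nat_Bijection"
begin

text \<open>
  Over a field with \<open>q\<close> elements a subspace of dimension \<open>n\<close> has \<open>q\<^sup>n\<close> elements, so all ranks can be
  computed by counting. If \<open>q > 2\<^bsup>|E|\<^esup>\<close>, then the span of all the \<open>V\<^sub>e\<close> is not covered by those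
  spans of subfamilies that are proper, so it contains a vector outside all of them; the quotient
  by this vector lowers the rank exactly of the sets of full rank. Iterating this truncates by any
  integer. The field can be enlarged beforehand by repeated quadratic extensions; base change
  preserves ranks because an extension \<open>S\<close> of \<open>R\<close> has an \<open>R\<close>-linear retraction onto \<open>R\<close>.
  For real \<open>\<epsilon>\<close>, truncate the multiples \<open>m h\<close> (direct sums) by \<open>\<lfloor>m \<epsilon>\<rfloor>\<close> and rescale by \<open>1/m\<close>.
\<close>

section \<open>Spans over a finite field\<close>

locale finite_field = field R for R (structure) +
  assumes finite_carrier: "finite (carrier R)"
begin

abbreviation q :: nat where "q \<equiv> card (carrier R)"

lemma q_ge_2: "2 \<le> q"
proof -
  have "card {\<zero>, \<one>} \<le> q"
    by (rule card_mono) (auto simp: finite_carrier)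
  then show ?thesis by simp
qed

end

section \<open>Closure properties of the span operator\<close>

lemma fspan_mono: "S \<subseteq> T \<Longrightarrow> fspan R d S \<subseteq> fspan R d T"
proof
  fix x assume "S \<subseteq> T" "x \<in> fspan R d S"
  from this(2) show "x \<in> fspan R d T"
    by induction (use \<open>S \<subseteq> T\<close> in \<open>auto intro: fspan.intros\<close>)
qed

lemma fspan_superset: "S \<subseteq> fspan R d S"
  by (auto intro: fspan.intros)

lemma fspan_subset_fspanI:
  assumes "S \<subseteq> fspan R d T" shows "fspan R d S \<subseteq> fspan R d T"
proof
  fix x assume "x \<in> fspan R d S"
  then show "x \<in> fspan R d T"
    by induction (use assms in \<open>auto intro: fspan.intros\<close>)
qed

lemma fspan_idem [simp]: "fspan R d (fspan R d S) = fspan R d S"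
  by (intro equalityI fspan_subset_fspanI fspan_superset subset_refl)

lemma fspan_UN_fspan: "fspan R d (\<Union>e\<in>A. fspan R d (T e)) = fspan R d (\<Union>e\<in>A. T e)"
proof (rule equalityI)
  show "fspan R d (\<Union>e\<in>A. fspan R d (T e)) \<subseteq> fspan R d (\<Union>e\<in>A. T e)"
    by (intro fspan_subset_fspanI UN_least fspan_mono) blast
  show "fspan R d (\<Union>e\<in>A. T e) \<subseteq> fspan R d (\<Union>e\<in>A. fspan R d (T e))"
    by (intro fspan_mono UN_mono fspan_superset subset_refl)
qed

lemma fspan_insert_redundant:
  assumes "b \<in> fspan R d S" shows "fspan R d (insert b S) = fspan R d S"
  using assms fspan_superset[of S R d]
  by (intro equalityI fspan_subset_fspanI fspan_mono) auto

text \<open>Linearity of \<open>f\<close> is asked for only on the span of \<open>S\<close>, since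
  maps such as \<open>project\<close> obey the linear laws only on vectors with entries in the
  carrier. The bound \<open>d'\<close> is free because the rules of \<open>fspan\<close> do not look
  at it.\<close>

lemma fspan_image:
  assumes zero: "f (fzero R) = fzero R"
    and add: "\<And>v w. v \<in> fspan R d S \<Longrightarrow> w \<in> fspan R d S \<Longrightarrow> f (fadd R v w) = fadd R (f v) (f w)"
    and smult: "\<And>c v. c \<in> carrier R \<Longrightarrow> v \<in> fspan R d S \<Longrightarrow> f (fsmult R c v) = fsmult R c (f v)"
  shows "fspan R d' (f ` S) = f ` fspan R d S"
proof (intro equalityI subsetI)
  fix x assume "x \<in> fspan R d' (f ` S)"
  then show "x \<in> f ` fspan R d S"
  proof induction
    case span_zero
    then show ?case by (metis fspan.span_zero image_eqI zero)
  next
    case (span_base v)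
    then show ?case by (auto intro: fspan.intros)
  next
    case (span_add v w)
    then obtain v' w' where "v' \<in> fspan R d S" "w' \<in> fspan R d S" "v = f v'" "w = f w'" by auto
    then show ?case using add[of v' w'] by (metis fspan.span_add image_eqI)
  next
    case (span_smult c v)
    then obtain v' where "v' \<in> fspan R d S" "v = f v'" by auto
    then show ?case using smult[of c v'] span_smult by (metis fspan.span_smult image_eqI)
  qed
next
  fix y assume "y \<in> f ` fspan R d S"
  then obtain x where "x \<in> fspan R d S" "y = f x" by auto
  then have "x \<in> fspan R d S \<and> f x \<in> fspan R d' (f ` S)"
  proof (induction arbitrary: y)
    case span_zero
    then show ?case by (auto simp: zero intro: fspan.intros)
  next
    case (span_base v)
    then show ?case by (auto intro: fspan.intros)
  next
    case (span_add v w)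
    then show ?case by (auto simp: add intro: fspan.intros)
  next
    case (span_smult c v)
    then show ?case by (auto simp: smult intro: fspan.intros)
  qed
  then show "y \<in> fspan R d' (f ` S)" using \<open>y = f x\<close> by simp
qed

text \<open>Vectors are padded by zeros from coordinate \<open>d\<close> on, so every index is
  allowed.\<close>

lemma (in cring) fvecD: "v \<in> fvec R d \<Longrightarrow> v i \<in> carrier R"
  by (cases "i < d") (auto simp: fvec_def)

lemma (in cring) fspan_subset_fvec:
  assumes "S \<subseteq> fvec R d" shows "fspan R d S \<subseteq> fvec R d"
proof
  fix x assume "x \<in> fspan R d S"
  then show "x \<in> fvec R d"
    by induction (use assms in \<open>auto simp: fvec_def fzero_def fadd_def fsmult_def\<close>)
qed

section \<open>Sizes of spans and their relation to dimension\<close>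

context finite_field
begin

lemma finite_fvec: "finite (fvec R d)"
proof -
  have "fvec R d \<subseteq> {f. \<forall>x. (x \<in> {..<d} \<longrightarrow> f x \<in> carrier R) \<and> (x \<notin> {..<d} \<longrightarrow> f x = \<zero>)}"
    by (auto simp: fvec_def)
  then show ?thesis
    by (rule finite_subset) (rule finite_set_of_finite_funs; simp add: finite_carrier)
qed

lemma finite_fspan: "S \<subseteq> fvec R d \<Longrightarrow> finite (fspan R d S)"
  using finite_subset[OF fspan_subset_fvec finite_fvec] .

text \<open>The sums of a multiple of \<open>b\<close> and an element of the span of
  \<open>S\<close> contain all generators and are closed under the vector operations. This
  parametrization is what gets counted below.\<close>

lemma fspan_insert:
  assumes S: "S \<subseteq> fvec R d" and b: "b \<in> fvec R d"
  shows "fspan R d (insert b S) = (\<lambda>(c, w). fadd R (fsmult R c b) w) ` (carrier R \<times> fspan R d S)"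
    (is "_ = ?f ` ?D")
proof (intro equalityI subsetI)
  have wS: "w i \<in> carrier R" if "w \<in> fspan R d S" for w i
    using fspan_subset_fvec[OF S] that fvecD by blast
  have b': "b i \<in> carrier R" for i using b fvecD by blast
  fix x assume "x \<in> fspan R d (insert b S)"
  then show "x \<in> ?f ` ?D"
  proof induction
    case span_zero
    have "fzero R = ?f (\<zero>, fzero R)" by (auto simp: fzero_def fadd_def fsmult_def b')
    then show ?case by (rule image_eqI) (auto intro: fspan.intros)
  next
    case (span_base v)
    then consider "v = b" | "v \<in> S" by auto
    then show ?case
    proof cases
      case 1
      have "b = ?f (\<one>, fzero R)" by (auto simp: fzero_def fadd_def fsmult_def b')
      then show ?thesis unfolding 1 by (rule image_eqI) (auto intro: fspan.intros)
    next
      case 2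
      then have "v = ?f (\<zero>, v)"
        using wS[OF fspan.span_base] by (auto simp: fzero_def fadd_def fsmult_def b')
      then show ?thesis by (rule image_eqI) (use 2 in \<open>auto intro: fspan.intros\<close>)
    qed
  next
    case (span_add v w)
    then obtain c v' c' w' where *: "c \<in> carrier R" "c' \<in> carrier R" "v' \<in> fspan R d S"
      "w' \<in> fspan R d S" "v = ?f (c, v')" "w = ?f (c', w')" by auto
    have "fadd R v w = ?f (c \<oplus> c', fadd R v' w')"
      unfolding * by (auto simp: fadd_def fsmult_def b' wS * l_distr a_ac)
    then show ?case by (rule image_eqI) (use * in \<open>auto intro: fspan.intros\<close>)
  next
    case (span_smult c v)
    then obtain c' v' where *: "c' \<in> carrier R" "v' \<in> fspan R d S" "v = ?f (c', v')" by auto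
    have "fsmult R c v = ?f (c \<otimes> c', fsmult R c v')"
      unfolding * by (auto simp: fadd_def fsmult_def b' wS * span_smult r_distr m_assoc)
    then show ?case by (rule image_eqI) (use * span_smult in \<open>auto intro: fspan.intros\<close>)
  qed
next
  fix x assume "x \<in> ?f ` ?D"
  then show "x \<in> fspan R d (insert b S)"
    using fspan_mono[of S "insert b S" R d]
    by (auto intro!: fspan.span_add fspan.span_smult intro: fspan.span_base)
qed

text \<open>Division by \<open>c\<close>. It is used in contrapositive form: if \<open>b\<close>
  lies outside the span, a multiple of \<open>b\<close> inside it must have coefficient
  zero.\<close>

lemma in_fspan_of_multiple:
  assumes S: "S \<subseteq> fvec R d" and b: "b \<in> fvec R d" and "c \<in> carrier R" "c \<noteq> \<zero>"
    and "fsmult R c b \<in> fspan R d S"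
  shows "b \<in> fspan R d S"
proof -
  have "b i \<in> carrier R" for i using b fvecD by blast
  then have "b = fsmult R (inv c) (fsmult R c b)"
    using assms(3,4) by (auto simp: fsmult_def field_Units m_assoc[symmetric])
  moreover have "fsmult R (inv c) (fsmult R c b) \<in> fspan R d S"
    using assms(3-5) by (intro fspan.span_smult[OF _ assms(5)]) (auto simp: field_Units)
  ultimately show ?thesis by simp
qed

lemma fspan_diff:
  assumes S: "S \<subseteq> fvec R d" and "v \<in> fspan R d S" "w \<in> fspan R d S"
  shows "(\<lambda>i. v i \<ominus> w i) \<in> fspan R d S"
proof -
  have "w i \<in> carrier R" for i using fspan_subset_fvec[OF S] assms(3) fvecD by blast
  then have "(\<lambda>i. v i \<ominus> w i) = fadd R v (fsmult R (\<ominus> \<one>) w)"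
    by (auto simp: fadd_def fsmult_def a_minus_def l_minus)
  then show ?thesis using assms by (auto intro!: fspan.span_add fspan.span_smult)
qed

text \<open>The parametrization in \<open>fspan_insert\<close> becomes injective: two
  representations of one vector put the multiple of \<open>b\<close> by
  \<open>c \<ominus> c'\<close> into the span of \<open>S\<close>, which forces
  \<open>c = c'\<close> and then \<open>w = w'\<close>.\<close>

lemma card_fspan_insert:
  assumes S: "S \<subseteq> fvec R d" and b: "b \<in> fvec R d" and notin: "b \<notin> fspan R d S"
  shows "card (fspan R d (insert b S)) = q * card (fspan R d S)"
proof -
  have "inj_on (\<lambda>(c, w). fadd R (fsmult R c b) w) (carrier R \<times> fspan R d S)"
  proof (rule inj_onI, clarify)
    fix c w c' w'
    assume c: "c \<in> carrier R" "c' \<in> carrier R" and w: "w \<in> fspan R d S" "w' \<in> fspan R d S"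
      and eq: "fadd R (fsmult R c b) w = fadd R (fsmult R c' b) w'"
    have car: "w i \<in> carrier R" "w' i \<in> carrier R" "b i \<in> carrier R" for i
      using fspan_subset_fvec[OF S] w b fvecD by blast+
    have eq': "c \<otimes> b i \<oplus> w i = c' \<otimes> b i \<oplus> w' i" for i
      using fun_cong[OF eq, of i] by (simp add: fadd_def fsmult_def)
    have "(c \<ominus> c') \<otimes> b i = w' i \<ominus> w i" for i
    proof -
      have "(c \<ominus> c') \<otimes> b i = (c \<otimes> b i \<oplus> w i) \<ominus> (c' \<otimes> b i \<oplus> w i)"
        using c car[of i] by algebra
      also have "\<dots> = (c' \<otimes> b i \<oplus> w' i) \<ominus> (c' \<otimes> b i \<oplus> w i)" using eq' by simp
      also have "\<dots> = w' i \<ominus> w i" using c car[of i] by algebra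
      finally show ?thesis .
    qed
    then have "fsmult R (c \<ominus> c') b \<in> fspan R d S"
      using fspan_diff[OF S w(2,1)] by (simp add: fsmult_def)
    then have "c \<ominus> c' = \<zero>"
      using in_fspan_of_multiple[OF S b, of "c \<ominus> c'"] notin c by blast
    moreover have "c = (c \<ominus> c') \<oplus> c'" using c by algebra
    ultimately have "c = c'" using c by simp
    moreover have "w i = w' i" for i
    proof -
      have "w i = (c' \<otimes> b i \<oplus> w i) \<ominus> c' \<otimes> b i" using c car[of i] by algebra
      also have "\<dots> = (c' \<otimes> b i \<oplus> w' i) \<ominus> c' \<otimes> b i" using eq'[of i] \<open>c = c'\<close> by simp
      also have "\<dots> = w' i" using c car[of i] by algebra
      finally show ?thesis .
    qed
    ultimately show "c = c' \<and> w = w'" by blast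
  qed
  then show ?thesis
    unfolding fspan_insert[OF S b] by (simp add: card_image card_cartesian_product)
qed

lemma card_fspan_empty: "card (fspan R d {}) = 1"
proof -
  have "x \<in> fspan R d {} \<Longrightarrow> x = fzero R" for x
    by (induction rule: fspan.induct) (auto simp: fzero_def fadd_def fsmult_def)
  then have "fspan R d {} = {fzero R}" by (auto intro: fspan.intros)
  then show ?thesis by simp
qed

text \<open>Greedy selection: a vector is kept only if it lies outside the span of the earlier ones,
  and each kept vector multiplies the size of the span by \<open>q\<close>.\<close>

lemma obtain_basis:
  assumes "finite T" "T \<subseteq> fvec R d"
  obtains B where "B \<subseteq> T" "finite B" "fspan R d B = fspan R d T" "card (fspan R d T) = q ^ card B"
proof -
  have "\<exists>B\<subseteq>T. finite B \<and> fspan R d B = fspan R d T \<and> card (fspan R d T) = q ^ card B"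
    using assms
  proof (induction T)
    case empty
    then show ?case by (simp add: card_fspan_empty)
  next
    case (insert b T)
    then obtain B where B: "B \<subseteq> T" "finite B" "fspan R d B = fspan R d T" "card (fspan R d T) = q ^ card B"
      by auto
    show ?case
    proof (cases "b \<in> fspan R d T")
      case True
      then show ?thesis using B by (intro exI[of _ B]) (auto simp: fspan_insert_redundant)
    next
      case False
      have b: "b \<in> fvec R d" and T: "T \<subseteq> fvec R d" "B \<subseteq> fvec R d" using insert.prems B by auto
      have "b \<notin> B" using False B fspan_superset by blast
      then have "card (fspan R d (insert b T)) = q ^ card (insert b B)"
        using B card_fspan_insert[OF T(1) b False] by simp
      moreover have "fspan R d (insert b B) = fspan R d (insert b T)"
        using B unfolding fspan_insert[OF T(1) b] fspan_insert[OF T(2) b] by simp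
      ultimately show ?thesis using B by (intro exI[of _ "insert b B"]) auto
    qed
  qed
  then show thesis using that by blast
qed

lemma card_fspan_le:
  assumes "finite B" "B \<subseteq> fvec R d" shows "card (fspan R d B) \<le> q ^ card B"
proof -
  obtain C where "C \<subseteq> B" "card (fspan R d B) = q ^ card C"
    using obtain_basis[OF assms] by metis
  then show ?thesis
    using assms(1) q_ge_2 by (simp add: card_mono power_increasing)
qed

text \<open>The basis \<open>B\<close> from \<open>obtain_basis\<close> attains the minimum in
  \<open>fdim\<close>: any spanning set with \<open>n\<close> elements generates at most
  \<open>q ^ n\<close> vectors, so \<open>n\<close> cannot be below \<open>card B\<close>. From here
  on ranks are exponents of cardinalities.\<close>

lemma card_fspan_eq_power_fdim:
  assumes T: "T \<subseteq> fvec R d"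
  shows "card (fspan R d T) = q ^ fdim R d (fspan R d T)"
proof -
  have fin: "finite T" using T finite_fvec finite_subset by blast
  obtain B where B: "B \<subseteq> T" "finite B" "fspan R d B = fspan R d T" "card (fspan R d T) = q ^ card B"
    using obtain_basis[OF fin T] by metis
  have "fdim R d (fspan R d T) = card B"
    unfolding fdim_def
  proof (rule Least_equality)
    show "\<exists>B'\<subseteq>fspan R d T. finite B' \<and> card B' = card B \<and> fspan R d B' = fspan R d T"
      using B fspan_superset[of T R d] by (intro exI[of _ B]) auto
  next
    fix n assume "\<exists>C\<subseteq>fspan R d T. finite C \<and> card C = n \<and> fspan R d C = fspan R d T"
    then obtain C where C: "C \<subseteq> fspan R d T" "finite C" "card C = n" "fspan R d C = fspan R d T"
      by blast
    then have "q ^ card B \<le> q ^ n"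
      using card_fspan_le[of C d] fspan_subset_fvec[OF T] B by auto
    then show "card B \<le> n" using q_ge_2 by (simp add: power_le_imp_le_exp)
  qed
  then show ?thesis using B by simp
qed

text \<open>Adjoining one vector of the difference to \<open>S\<close> already multiplies the size
  by \<open>q\<close> and stays inside the larger span.\<close>

lemma card_fspan_proper_subset:
  assumes S: "S \<subseteq> fvec R d" and T: "T \<subseteq> fvec R d" and "fspan R d S \<subset> fspan R d T"
  shows "q * card (fspan R d S) \<le> card (fspan R d T)"
proof -
  obtain b where b: "b \<in> fspan R d T" "b \<notin> fspan R d S" using assms(3) by blast
  have "S \<subseteq> fspan R d T" using assms(3) fspan_superset by blast
  then have "fspan R d (insert b S) \<subseteq> fspan R d T"
    using b by (intro fspan_subset_fspanI) auto
  then have "card (fspan R d (insert b S)) \<le> card (fspan R d T)"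
    by (intro card_mono finite_fspan T)
  then show ?thesis
    using card_fspan_insert[OF S _ b(2)] b(1) fspan_subset_fvec[OF T] by auto
qed

end


section \<open>Representations by spanning families\<close>

text \<open>Subspaces are given by arbitrary generating sets and ranks by the exponents
  \<open>n A\<close>, so that later constructions can transform generators and count, without
  returning to \<open>fdim\<close>. The field is a parameter because it changes under base
  change.\<close>

definition span_rep :: "('a, 'b) ring_scheme \<Rightarrow> 'e set \<Rightarrow> ('e set \<Rightarrow> real) \<Rightarrow> bool" where
  "span_rep R E h \<longleftrightarrow>
     (\<exists>d T n. (\<forall>e\<in>E. T e \<subseteq> fvec R d) \<and>
        (\<forall>A\<subseteq>E. h A = real (n A) \<and> card (fspan R d (\<Union>e\<in>A. T e)) = card (carrier R) ^ n A))"

lemma span_repI: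
  assumes "\<And>e. e \<in> E \<Longrightarrow> T e \<subseteq> fvec R d" and "\<And>A. A \<subseteq> E \<Longrightarrow> h A = real (n A)"
    and "\<And>A. A \<subseteq> E \<Longrightarrow> card (fspan R d (\<Union>e\<in>A. T e)) = card (carrier R) ^ n A"
  shows "span_rep R E h"
  unfolding span_rep_def using assms by (intro exI[of _ d] exI[of _ T] exI[of _ n]) auto

lemma span_repE:
  assumes "span_rep R E h"
  obtains d T n where "\<And>e. e \<in> E \<Longrightarrow> T e \<subseteq> fvec R d" "\<And>A. A \<subseteq> E \<Longrightarrow> h A = real (n A)"
    "\<And>A. A \<subseteq> E \<Longrightarrow> card (fspan R d (\<Union>e\<in>A. T e)) = card (carrier R) ^ n A"
proof -
  from assms obtain d T n where "\<forall>e\<in>E. T e \<subseteq> fvec R d"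
    "\<forall>A\<subseteq>E. h A = real (n A) \<and> card (fspan R d (\<Union>e\<in>A. T e)) = card (carrier R) ^ n A"
    unfolding span_rep_def by (elim exE conjE)
  then show thesis by (intro that[of T d n]) auto
qed

text \<open>Subspaces generate themselves; conversely generating sets are replaced by their spans.
  The exponent agrees with \<open>fdim\<close> because powers of \<open>q \<ge> 2\<close> determine
  their exponents.\<close>

lemma q_representable_iff_span_rep:
  "q_representable q E h \<longleftrightarrow>
     (\<exists>R :: nat ring. finite_field R \<and> card (carrier R) = q \<and> span_rep R E h)"
proof
  assume "q_representable q E h"
  then obtain R :: "nat ring" and d and V :: "'a \<Rightarrow> (nat \<Rightarrow> nat) set" where
    R: "field R" "finite (carrier R)" "card (carrier R) = q"
    and V: "\<forall>e\<in>E. fsubspace R d (V e)"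
    and h: "\<forall>A\<subseteq>E. h A = real (fdim R d (fspan R d (\<Union>e\<in>A. V e)))"
    unfolding q_representable_def by blast
  interpret finite_field R using R by (simp add: finite_field_def finite_field_axioms_def)
  have "V e \<subseteq> fvec R d" if "e \<in> E" for e using V that by (auto simp: fsubspace_def)
  moreover from this have "card (fspan R d (\<Union>e\<in>A. V e)) = card (carrier R) ^ fdim R d (fspan R d (\<Union>e\<in>A. V e))"
    if "A \<subseteq> E" for A
    using that by (intro card_fspan_eq_power_fdim) blast
  ultimately have "span_rep R E h" using h by (intro span_repI[of E V R d]) blast+
  then show "\<exists>R :: nat ring. finite_field R \<and> card (carrier R) = q \<and> span_rep R E h"
    using R finite_field_axioms by blast
next
  assume "\<exists>R :: nat ring. finite_field R \<and> card (carrier R) = q \<and> span_rep R E h"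
  then obtain R :: "nat ring" where "finite_field R" and q: "card (carrier R) = q"
    and rep: "span_rep R E h" by blast
  obtain d T n where T: "\<And>e. e \<in> E \<Longrightarrow> T e \<subseteq> fvec R d"
    and h: "\<And>A. A \<subseteq> E \<Longrightarrow> h A = real (n A)"
    and card: "\<And>A. A \<subseteq> E \<Longrightarrow> card (fspan R d (\<Union>e\<in>A. T e)) = card (carrier R) ^ n A"
    by (rule span_repE[OF rep]) (rule that; simp)
  interpret finite_field R by fact
  have "fsubspace R d (fspan R d (T e))" if "e \<in> E" for e
    using T that fspan_subset_fvec by (simp add: fsubspace_def)
  moreover have "h A = real (fdim R d (fspan R d (\<Union>e\<in>A. fspan R d (T e))))" if A: "A \<subseteq> E" for A
  proof -
    have "(\<Union>e\<in>A. T e) \<subseteq> fvec R d" using T A by blast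
    from card_fspan_eq_power_fdim[OF this] card[OF A] q_ge_2
    have "n A = fdim R d (fspan R d (\<Union>e\<in>A. T e))" by (simp add: power_inject_exp)
    then show ?thesis using h[OF A] by (simp add: fspan_UN_fspan)
  qed
  ultimately show "q_representable q E h"
    unfolding q_representable_def
    using field_axioms finite_carrier q by (intro exI[of _ R] exI[of _ d] exI[of _ "\<lambda>e. fspan R d (T e)"]) auto
qed

section \<open>Quotient by a generic vector\<close>

context finite_field
begin

text \<open>A proper subspace fills at most a fraction \<open>1/q\<close> of the whole space, so
  fewer than \<open>q\<close> of them cannot cover it.\<close>

lemma obtain_generic_vector:
  assumes "finite I" and T: "\<And>i. i \<in> I \<Longrightarrow> T i \<subseteq> fvec R d" and S: "S \<subseteq> fvec R d"
    and sub: "\<And>i. i \<in> I \<Longrightarrow> fspan R d (T i) \<subset> fspan R d S" and "card I < q"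
  obtains u where "u \<in> fspan R d S" "\<And>i. i \<in> I \<Longrightarrow> u \<notin> fspan R d (T i)"
proof -
  let ?W = "\<lambda>i. fspan R d (T i)"
  have pos: "0 < card (fspan R d S)"
    using finite_fspan[OF S] fspan.span_zero[of R d S] by (auto simp: card_gt_0_iff)
  \<comment> \<open>The union bound is multiplied through by \<open>q\<close> to stay within the
    natural numbers.\<close>
  have "q * card (\<Union>i\<in>I. ?W i) \<le> q * (\<Sum>i\<in>I. card (?W i))"
    by (intro mult_le_mono2 card_UN_le assms(1))
  also have "\<dots> = (\<Sum>i\<in>I. q * card (?W i))" by (simp add: sum_distrib_left)
  also have "\<dots> \<le> (\<Sum>i\<in>I. card (fspan R d S))"
    by (intro sum_mono card_fspan_proper_subset T S sub)
  also have "\<dots> < q * card (fspan R d S)" using \<open>card I < q\<close> pos by simp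
  finally have less: "card (\<Union>i\<in>I. ?W i) < card (fspan R d S)" by simp
  have "finite (\<Union>i\<in>I. ?W i)" using assms(1) T finite_fspan by blast
  then have "\<not> fspan R d S \<subseteq> (\<Union>i\<in>I. ?W i)" using less card_mono by (metis not_le)
  then show thesis using that by blast
qed

text \<open>The quotient map by the line through \<open>u\<close>, realised inside the same
  coordinate space: the multiple of \<open>u\<close> that clears the pivot coordinate
  \<open>k\<close> is subtracted. On \<open>fvec R d\<close>, when \<open>u\<close> lies there and
  \<open>u k\<close> is nonzero, the kernel is exactly that line.\<close>

definition project :: "(nat \<Rightarrow> 'a) \<Rightarrow> nat \<Rightarrow> (nat \<Rightarrow> 'a) \<Rightarrow> nat \<Rightarrow> 'a" where
  "project u k v = (\<lambda>i. v i \<ominus> (v k \<otimes> inv (u k)) \<otimes> u i)"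

section \<open>Effect of projecting along a fixed vector on the size of a span\<close>

context
  fixes d :: nat and u :: "nat \<Rightarrow> 'a" and k :: nat
  assumes u: "u \<in> fvec R d" and uk: "u k \<noteq> \<zero>"
begin

lemma u_closed [simp]: "u i \<in> carrier R"
  using u fvecD by blast

lemma inv_uk_closed [simp]: "inv (u k) \<in> carrier R"
  using uk by (simp add: field_Units)

lemma project_in_fvec: "v \<in> fvec R d \<Longrightarrow> project u k v \<in> fvec R d"
  using u fvecD[of v d] by (auto simp: fvec_def project_def a_minus_def)

lemma project_pivot: "v \<in> fvec R d \<Longrightarrow> project u k v k = \<zero>"
  using fvecD[of v d k] uk
  by (simp add: project_def field_Units m_assoc a_minus_def r_neg)

lemma fspan_project:
  assumes S: "S \<subseteq> fvec R d"
  shows "fspan R d (project u k ` S) = project u k ` fspan R d S"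
proof (rule fspan_image)
  have car: "v i \<in> carrier R" if "v \<in> fspan R d S" for v i
    using fspan_subset_fvec[OF S] that fvecD by blast
  show "project u k (fzero R) = fzero R"
    by (auto simp: project_def fzero_def a_minus_def)
  show "project u k (fadd R v w) = fadd R (project u k v) (project u k w)"
    if "v \<in> fspan R d S" "w \<in> fspan R d S" for v w
  proof
    fix i
    show "project u k (fadd R v w) i = fadd R (project u k v) (project u k w) i"
      using car[OF that(1), of i] car[OF that(1), of k] car[OF that(2), of i] car[OF that(2), of k]
        u_closed[of i] inv_uk_closed
      unfolding project_def fadd_def by algebra
  qed
  show "project u k (fsmult R c v) = fsmult R c (project u k v)"
    if "c \<in> carrier R" "v \<in> fspan R d S" for c v
  proof
    fix i
    show "project u k (fsmult R c v) i = fsmult R c (project u k v) i"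
      using car[OF that(2), of i] car[OF that(2), of k] that(1) u_closed[of i] inv_uk_closed
      unfolding project_def fsmult_def by algebra
  qed
qed

lemma eq_fadd_project:
  assumes "v \<in> fvec R d"
  shows "v = fadd R (fsmult R (v k \<otimes> inv (u k)) u) (project u k v)"
proof
  fix i
  show "v i = fadd R (fsmult R (v k \<otimes> inv (u k)) u) (project u k v) i"
    using fvecD[OF assms, of i] fvecD[OF assms, of k] u_closed[of i] inv_uk_closed
    unfolding project_def fsmult_def fadd_def by algebra
qed

text \<open>The kernel of the projection meets the span of \<open>S\<close> only in zero, so the
  projection is injective there.\<close>

lemma card_fspan_project_notin:
  assumes S: "S \<subseteq> fvec R d" and notin: "u \<notin> fspan R d S"
  shows "card (fspan R d (project u k ` S)) = card (fspan R d S)"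
proof -
  have "inj_on (project u k) (fspan R d S)"
  proof (rule inj_onI)
    fix v w assume v: "v \<in> fspan R d S" and w: "w \<in> fspan R d S"
      and eq: "project u k v = project u k w"
    have v': "v \<in> fvec R d" and w': "w \<in> fvec R d" using v w fspan_subset_fvec[OF S] by auto
    note car = fvecD[OF v'] fvecD[OF w']
    \<comment> \<open>Vectors with equal projections differ by a multiple of
      \<open>u\<close>.\<close>
    have coeff: "v i \<ominus> w i = (v k \<otimes> inv (u k) \<ominus> w k \<otimes> inv (u k)) \<otimes> u i" for i
    proof -
      have "v i \<ominus> w i = (v k \<otimes> inv (u k) \<ominus> w k \<otimes> inv (u k)) \<otimes> u i \<oplus> (project u k v i \<ominus> project u k w i)"
        using car(1)[of i] car(1)[of k] car(2)[of i] car(2)[of k] u_closed[of i] inv_uk_closed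
        unfolding project_def by algebra
      moreover have "project u k w i \<in> carrier R"
        using project_in_fvec[OF w'] fvecD by blast
      ultimately show ?thesis unfolding eq using car by (simp add: a_minus_def r_neg)
    qed
    let ?c = "v k \<otimes> inv (u k) \<ominus> w k \<otimes> inv (u k)"
    have "fsmult R ?c u \<in> fspan R d S"
      using fspan_diff[OF S v w] by (simp add: fsmult_def coeff)
    then have "?c = \<zero>"
      using in_fspan_of_multiple[OF S u, of ?c] notin car by auto
    then have diff: "v i \<ominus> w i = \<zero>" for i using coeff[of i] by simp
    have "v i = w i" for i
    proof -
      have "v i = (v i \<ominus> w i) \<oplus> w i" using car(1)[of i] car(2)[of i] by algebra
      then show ?thesis using diff[of i] car by simp
    qed
    then show "v = w" by auto
  qed
  then show ?thesis unfolding fspan_project[OF S] by (rule card_image)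
qed

text \<open>Projected vectors vanish at the pivot \<open>k\<close> while \<open>u\<close> does not,
  so \<open>u\<close> lies outside the projected span; adjoining it recovers the original span and
  accounts for the factor \<open>q\<close>.\<close>

lemma card_fspan_project_in:
  assumes S: "S \<subseteq> fvec R d" and "u \<in> fspan R d S"
  shows "card (fspan R d S) = q * card (fspan R d (project u k ` S))"
proof -
  have S': "project u k ` S \<subseteq> fvec R d" using S project_in_fvec by blast
  have "u \<notin> fspan R d (project u k ` S)"
  proof
    assume "u \<in> fspan R d (project u k ` S)"
    then obtain x where "x \<in> fspan R d S" "u = project u k x" unfolding fspan_project[OF S] by blast
    then show False using project_pivot[of x] fspan_subset_fvec[OF S] uk by auto
  qed
  moreover have "fspan R d (insert u (project u k ` S)) = fspan R d S"
  proof (intro equalityI fspan_subset_fspanI subsetI)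
    fix x assume "x \<in> insert u (project u k ` S)"
    then consider "x = u" | v where "v \<in> S" "x = project u k v" by auto
    then show "x \<in> fspan R d S"
    proof cases
      case 2
      have "v i \<in> carrier R" for i using 2 S fvecD by blast
      then have "fsmult R (v k \<otimes> inv (u k)) u \<in> fspan R d S" using assms(2) by (intro fspan.span_smult) auto
      from fspan_diff[OF S fspan.span_base[OF 2(1)] this]
      show ?thesis unfolding 2 project_def fsmult_def .
    qed (simp add: assms(2))
  next
    fix v assume "v \<in> S"
    then have "v \<in> fvec R d" using S by blast
    moreover have "v k \<otimes> inv (u k) \<in> carrier R" using fvecD[OF \<open>v \<in> fvec R d\<close>] by simp
    ultimately show "v \<in> fspan R d (insert u (project u k ` S))"
      using \<open>v \<in> S\<close> by (subst eq_fadd_project) (auto intro!: fspan.span_add fspan.span_smult intro: fspan.span_base)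
  qed
  ultimately show ?thesis using card_fspan_insert[OF S' u] by simp
qed

end

text \<open>A vector \<open>u\<close> is chosen in the full span but in no proper
  \<open>W A\<close>. Projecting along \<open>u\<close> lowers the rank by one where
  \<open>W A = W E\<close> and leaves it alone elsewhere, where it is at most \<open>n E - 1\<close>
  anyway.\<close>

lemma span_rep_truncate_one:
  assumes E: "finite E" and big: "2 ^ card E < q" and rep: "span_rep R E h" and hE: "1 \<le> h E"
  shows "span_rep R E (\<lambda>A. min (h A) (h E - 1))"
proof -
  obtain d T n where T: "\<And>e. e \<in> E \<Longrightarrow> T e \<subseteq> fvec R d"
    and h: "\<And>A. A \<subseteq> E \<Longrightarrow> h A = real (n A)"
    and card: "\<And>A. A \<subseteq> E \<Longrightarrow> card (fspan R d (\<Union>e\<in>A. T e)) = q ^ n A"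
    by (rule span_repE[OF rep]) (rule that; simp)
  define U where "U A = (\<Union>e\<in>A. T e)" for A
  define W where "W A = fspan R d (U A)" for A
  have U: "U A \<subseteq> fvec R d" if "A \<subseteq> E" for A using T that unfolding U_def by blast
  have W_mono: "W A \<subseteq> W E" if "A \<subseteq> E" for A
    using that unfolding W_def U_def by (intro fspan_mono) blast
  \<comment> \<open>The subsets whose spans \<open>u\<close> has to avoid; there are at most
    \<open>2 ^ card E\<close> of them, fewer than \<open>q\<close>.\<close>
  define P where "P = {A. A \<subseteq> E \<and> W A \<noteq> W E}"
  have "P \<subseteq> Pow E" by (auto simp: P_def)
  then have "finite P" "card P \<le> 2 ^ card E"
    using E by (auto simp: card_Pow[symmetric] intro: finite_subset card_mono)
  have psub: "fspan R d (U A) \<subset> fspan R d (U E)" if "A \<in> P" for A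
    using that W_mono[of A] by (auto simp: P_def W_def)
  obtain u where uE: "u \<in> W E" and uP: "\<And>A. A \<in> P \<Longrightarrow> u \<notin> W A"
    unfolding W_def
  proof (rule obtain_generic_vector[OF \<open>finite P\<close> _ _ psub])
    show "U A \<subseteq> fvec R d" if "A \<in> P" for A using U that by (auto simp: P_def)
    show "U E \<subseteq> fvec R d" using U by blast
    show "card P < q" using \<open>card P \<le> 2 ^ card E\<close> big by simp
  qed (use that in \<open>auto simp: W_def\<close>)
  have W_card: "card (W A) = q ^ n A" if "A \<subseteq> E" for A
    using card[OF that] by (simp add: W_def U_def)
  have "n E \<ge> 1" using hE h[of E] by simp
  \<comment> \<open>Since \<open>n E\<close> is positive, the empty set belongs to \<open>P\<close>;
    avoiding its span makes \<open>u\<close> nonzero and provides a pivot.\<close>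
  have "W {} \<noteq> W E"
  proof
    assume "W {} = W E"
    then have "q ^ n E = 1" using W_card[of E] card_fspan_empty[of d] by (simp add: W_def U_def)
    then show False using q_ge_2 \<open>n E \<ge> 1\<close> by simp
  qed
  then have "u \<notin> W {}" using uP[of "{}"] by (simp add: P_def)
  then have "u \<noteq> fzero R" using fspan.span_zero[of R d "U {}"] by (auto simp: W_def)
  then obtain k where k: "u k \<noteq> \<zero>" by (auto simp: fzero_def)
  have uv: "u \<in> fvec R d" using uE fspan_subset_fvec[OF U[of E]] by (auto simp: W_def)
  define T' where "T' e = project u k ` T e" for e
  show ?thesis
  proof (rule span_repI)
    show "T' e \<subseteq> fvec R d" if "e \<in> E" for e
      using T[OF that] project_in_fvec[OF uv k] by (auto simp: T'_def)
  next
    fix A assume A: "A \<subseteq> E"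
    have T': "(\<Union>e\<in>A. T' e) = project u k ` U A" by (auto simp: T'_def U_def)
    have "min (h A) (h E - 1) = real (min (n A) (n E - 1)) \<and>
      card (fspan R d (\<Union>e\<in>A. T' e)) = q ^ min (n A) (n E - 1)"
    proof (cases "W A = W E")
      case True
      then have nA: "n A = n E" using W_card[OF A] W_card[of E] q_ge_2 by (simp add: power_inject_exp)
      have "q * card (fspan R d (\<Union>e\<in>A. T' e)) = q ^ n E"
        using card_fspan_project_in[OF uv k U[OF A]] uE True W_card[of E] unfolding T' W_def by simp
      also have "q ^ n E = q * q ^ (n E - 1)" using \<open>n E \<ge> 1\<close> by (cases "n E") auto
      finally have "card (fspan R d (\<Union>e\<in>A. T' e)) = q ^ (n E - 1)" using q_ge_2 by simp
      then show ?thesis using nA \<open>n E \<ge> 1\<close> h[OF A] h[of E] by simp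
    next
      case False
      then have "W A \<subset> W E" using W_mono[OF A] by blast
      then have "card (W A) < card (W E)"
        unfolding W_def by (intro psubset_card_mono finite_fspan U) auto
      then have "n A < n E" using W_card[OF A] W_card[of E] q_ge_2 by (simp add: power_strict_increasing_iff)
      moreover have "u \<notin> fspan R d (U A)" using uP[of A] False A by (simp add: P_def W_def)
      then have "card (fspan R d (\<Union>e\<in>A. T' e)) = q ^ n A"
        using card_fspan_project_notin[OF uv k U[OF A]] W_card[OF A] unfolding T' W_def by simp
      ultimately show ?thesis using h[OF A] h[of E] by (simp add: min_absorb1)
    qed
    then show "min (h A) (h E - 1) = real (min (n A) (n E - 1))"
      and "card (fspan R d (\<Union>e\<in>A. T' e)) = q ^ min (n A) (n E - 1)" by blast+
  qed
qed

lemma span_rep_truncate: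
  assumes E: "finite E" and big: "2 ^ card E < q" and rep: "span_rep R E h" and "real k \<le> h E"
  shows "span_rep R E (\<lambda>A. min (h A) (h E - real k))"
  using \<open>real k \<le> h E\<close>
proof (induction k)
  case 0
  obtain d T n where T: "\<And>e. e \<in> E \<Longrightarrow> T e \<subseteq> fvec R d"
    and h: "\<And>A. A \<subseteq> E \<Longrightarrow> h A = real (n A)"
    and card: "\<And>A. A \<subseteq> E \<Longrightarrow> card (fspan R d (\<Union>e\<in>A. T e)) = q ^ n A"
    by (rule span_repE[OF rep]) (rule that; simp)
  \<comment> \<open>Truncation by zero returns \<open>h\<close> itself because \<open>h E\<close> is
    the largest value, which is read off from inclusion of spans.\<close>
  have "h A \<le> h E" if A: "A \<subseteq> E" for A
  proof -
    have "q ^ n A \<le> q ^ n E" unfolding card[OF A, symmetric] card[OF subset_refl, symmetric]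
      using A T by (intro card_mono finite_fspan fspan_mono) blast+
    then show ?thesis using h[OF A] h[of E] q_ge_2 by (simp add: power_le_imp_le_exp)
  qed
  then show ?case using T h card by (intro span_repI[of E T R d _ n]) (simp_all add: min_absorb1)
next
  case (Suc k)
  then have "span_rep R E (\<lambda>A. min (h A) (h E - real k))" by simp
  \<comment> \<open>\<open>min (h E) (h E - real k)\<close> is the value at \<open>E\<close> of the
    function already truncated by \<open>k\<close>, to which the single step is now applied.\<close>
  moreover have "1 \<le> min (h E) (h E - real k)" using Suc.prems by simp
  ultimately have "span_rep R E (\<lambda>A. min (min (h A) (h E - real k)) (min (h E) (h E - real k) - 1))"
    using span_rep_truncate_one[OF E big] by blast
  moreover have "min (min (h A) (h E - real k)) (min (h E) (h E - real k) - 1)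
      = min (h A) (h E - real (Suc k))" for A by auto
  ultimately show ?case by simp
qed

end

section \<open>Direct sums\<close>

lemma (in cring) fspan_Un:
  assumes A: "A \<subseteq> fvec R d" and B: "B \<subseteq> fvec R d"
  shows "fspan R d (A \<union> B) = (\<lambda>(v, w). fadd R v w) ` (fspan R d A \<times> fspan R d B)"
    (is "_ = ?f ` ?D")
proof (intro equalityI subsetI)
  have cA: "v i \<in> carrier R" if "v \<in> fspan R d A" for v i
    using fspan_subset_fvec[OF A] that fvecD by blast
  have cB: "v i \<in> carrier R" if "v \<in> fspan R d B" for v i
    using fspan_subset_fvec[OF B] that fvecD by blast
  fix x assume "x \<in> fspan R d (A \<union> B)"
  then show "x \<in> ?f ` ?D"
  proof induction
    case span_zero
    have "fzero R = ?f (fzero R, fzero R)" by (auto simp: fzero_def fadd_def)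
    then show ?case by (rule image_eqI) (auto intro: fspan.intros)
  next
    case (span_base v)
    then consider "v \<in> A" | "v \<in> B" by auto
    then show ?case
    proof cases
      case 1
      then have "v = ?f (v, fzero R)"
        using cA[OF fspan.span_base] by (auto simp: fzero_def fadd_def)
      then show ?thesis by (rule image_eqI) (use 1 in \<open>auto intro: fspan.intros\<close>)
    next
      case 2
      then have "v = ?f (fzero R, v)"
        using cB[OF fspan.span_base] by (auto simp: fzero_def fadd_def)
      then show ?thesis by (rule image_eqI) (use 2 in \<open>auto intro: fspan.intros\<close>)
    qed
  next
    case (span_add v w)
    then obtain v1 v2 w1 w2 where *: "v1 \<in> fspan R d A" "w1 \<in> fspan R d A" "v2 \<in> fspan R d B"
      "w2 \<in> fspan R d B" "v = ?f (v1, v2)" "w = ?f (w1, w2)" by auto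
    have "fadd R v w = ?f (fadd R v1 w1, fadd R v2 w2)"
      unfolding * by (auto simp: fadd_def cA cB * a_ac)
    then show ?case by (rule image_eqI) (use * in \<open>auto intro: fspan.intros\<close>)
  next
    case (span_smult c v)
    then obtain v1 v2 where *: "v1 \<in> fspan R d A" "v2 \<in> fspan R d B" "v = ?f (v1, v2)" by auto
    have "fsmult R c v = ?f (fsmult R c v1, fsmult R c v2)"
      unfolding * by (auto simp: fadd_def fsmult_def cA cB * span_smult r_distr)
    then show ?case by (rule image_eqI) (use * span_smult in \<open>auto intro: fspan.intros\<close>)
  qed
next
  fix x assume "x \<in> ?f ` ?D"
  then show "x \<in> fspan R d (A \<union> B)"
    using fspan_mono[of A "A \<union> B" R d] fspan_mono[of B "A \<union> B" R d]
    by (auto intro!: fspan.span_add)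
qed

text \<open>The identity map in \<open>fspan_image\<close>; it lets vectors of a small coordinate
  space be spanned inside a larger one.\<close>

lemma fspan_dim_irrelevant: "fspan R d S = fspan R d' S"
  using fspan_image[of "\<lambda>v. v" R d S d'] by simp

text \<open>Direct sum: the first family keeps its first \<open>d\<close> coordinates and the second
  is moved behind them by \<open>shift\<close>. Thanks to the zero padding the first family needs no
  change.\<close>

lemma (in cring) span_rep_add:
  assumes rep1: "span_rep R E g" and rep2: "span_rep R E h"
  shows "span_rep R E (\<lambda>A. g A + h A)"
proof -
  obtain d T n where T: "\<And>e. e \<in> E \<Longrightarrow> T e \<subseteq> fvec R d"
    and g: "\<And>A. A \<subseteq> E \<Longrightarrow> g A = real (n A)"
    and cardT: "\<And>A. A \<subseteq> E \<Longrightarrow> card (fspan R d (\<Union>e\<in>A. T e)) = card (carrier R) ^ n A"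
    by (rule span_repE[OF rep1]) (rule that; simp)
  obtain d' T' n' where T': "\<And>e. e \<in> E \<Longrightarrow> T' e \<subseteq> fvec R d'"
    and h: "\<And>A. A \<subseteq> E \<Longrightarrow> h A = real (n' A)"
    and cardT': "\<And>A. A \<subseteq> E \<Longrightarrow> card (fspan R d' (\<Union>e\<in>A. T' e)) = card (carrier R) ^ n' A"
    by (rule span_repE[OF rep2]) (rule that; simp)
  define shift where "shift w = (\<lambda>i. if i < d then \<zero> else w (i - d))" for w :: "nat \<Rightarrow> 'a"
  have fvec_shift: "shift w \<in> fvec R (d + d')" if "w \<in> fvec R d'" for w
    using that by (auto simp: shift_def fvec_def)
  have fvec_ext: "v \<in> fvec R (d + d')" if "v \<in> fvec R d" for v
    using that fvecD[OF that] by (auto simp: fvec_def)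
  have shift_span: "fspan R (d + d') (shift ` S) = shift ` fspan R d' S" for S
    by (rule fspan_image) (auto simp: shift_def fzero_def fadd_def fsmult_def)
  show ?thesis
  proof (rule span_repI)
    show "T e \<union> shift ` T' e \<subseteq> fvec R (d + d')" if "e \<in> E" for e
      using T[OF that] T'[OF that] fvec_shift fvec_ext by blast
    show "g A + h A = real (n A + n' A)" if "A \<subseteq> E" for A
      using g[OF that] h[OF that] by simp
  next
    fix A assume A: "A \<subseteq> E"
    let ?S = "fspan R d (\<Union>e\<in>A. T e)" and ?S' = "fspan R d' (\<Union>e\<in>A. T' e)"
    have UT: "(\<Union>e\<in>A. T e) \<subseteq> fvec R d" and UT': "(\<Union>e\<in>A. T' e) \<subseteq> fvec R d'"
      using T T' A by blast+
    have UT1: "(\<Union>e\<in>A. T e) \<subseteq> fvec R (d + d')" using UT fvec_ext by blast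
    have UT2: "shift ` (\<Union>e\<in>A. T' e) \<subseteq> fvec R (d + d')" using UT' fvec_shift by blast
    have S: "?S \<subseteq> fvec R d" and S': "?S' \<subseteq> fvec R d'"
      using fspan_subset_fvec UT UT' by auto
    have "(\<Union>e\<in>A. T e \<union> shift ` T' e) = (\<Union>e\<in>A. T e) \<union> shift ` (\<Union>e\<in>A. T' e)" by blast
    then have "fspan R (d + d') (\<Union>e\<in>A. T e \<union> shift ` T' e)
        = (\<lambda>(v, w). fadd R v w) ` (?S \<times> shift ` ?S')"
      using fspan_Un[OF UT1 UT2] by (simp only: shift_span fspan_dim_irrelevant[of R "d + d'" "\<Union>e\<in>A. T e" d])
    also have "\<dots> = (\<lambda>(v, w). fadd R v (shift w)) ` (?S \<times> ?S')" by force
    also have "card \<dots> = card (?S \<times> ?S')"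
    \<comment> \<open>The coordinates below \<open>d\<close> determine \<open>v\<close>, and the
      coordinates \<open>i + d\<close> determine \<open>w\<close>.\<close>
    proof (rule card_image, rule inj_onI, clarify)
      fix v w v' w' assume *: "v \<in> ?S" "w \<in> ?S'" "v' \<in> ?S" "w' \<in> ?S'"
        and eq: "fadd R v (shift w) = fadd R v' (shift w')"
      have fv: "v \<in> fvec R d" "v' \<in> fvec R d" "w \<in> fvec R d'" "w' \<in> fvec R d'"
        using * S S' by auto
      have "v i = v' i" for i
        using fun_cong[OF eq, of i] fv fvecD[OF fv(1)] fvecD[OF fv(2)]
        by (cases "i < d") (auto simp: fadd_def shift_def fvec_def)
      moreover have "w i = w' i" for i
        using fun_cong[OF eq, of "i + d"] fv fvecD[OF fv(3)] fvecD[OF fv(4)]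
        by (auto simp: fadd_def shift_def fvec_def)
      ultimately show "v = v' \<and> w = w'" by auto
    qed
    also have "\<dots> = card (carrier R) ^ (n A + n' A)"
      using cardT[OF A] cardT'[OF A] by (simp add: card_cartesian_product power_add)
    finally show "card (fspan R (d + d') (\<Union>e\<in>A. T e \<union> shift ` T' e)) = card (carrier R) ^ (n A + n' A)" .
  qed
qed

lemma (in cring) span_rep_multiple:
  assumes "span_rep R E h" shows "span_rep R E (\<lambda>A. real (Suc m) * h A)"
proof (induction m)
  case 0
  then show ?case using assms by simp
next
  case (Suc m)
  have "real (Suc (Suc m)) * h A = real (Suc m) * h A + h A" for A by (simp add: algebra_simps)
  then show ?case using span_rep_add[OF Suc assms] by simp
qed

section \<open>Base change\<close>

text \<open>The map \<open>\<pi>\<close> is only linear over the smaller field, not multiplicative.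
  With \<open>\<pi>_one\<close> it inverts \<open>\<iota>\<close> on the left, and this is what
  carries linear independence over \<open>R\<close> to \<open>S\<close>.\<close>

locale retracted_extension = R: finite_field R + S: finite_field S
  for R :: "('a, 'b) ring_scheme" (structure) and S :: "('c, 'd) ring_scheme" +
  fixes \<iota> :: "'a \<Rightarrow> 'c" and \<pi> :: "'c \<Rightarrow> 'a"
  assumes hom: "\<iota> \<in> ring_hom R S"
    and \<pi>_closed: "x \<in> carrier S \<Longrightarrow> \<pi> x \<in> carrier R"
    and \<pi>_add: "x \<in> carrier S \<Longrightarrow> y \<in> carrier S \<Longrightarrow> \<pi> (x \<oplus>\<^bsub>S\<^esub> y) = \<pi> x \<oplus> \<pi> y"
    and \<pi>_smult: "a \<in> carrier R \<Longrightarrow> x \<in> carrier S \<Longrightarrow> \<pi> (\<iota> a \<otimes>\<^bsub>S\<^esub> x) = a \<otimes> \<pi> x"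
    and \<pi>_one: "\<pi> \<one>\<^bsub>S\<^esub> = \<one>"
begin

lemma \<iota>_closed: "a \<in> carrier R \<Longrightarrow> \<iota> a \<in> carrier S"
  using ring_hom_closed[OF hom] .

lemma \<iota>_zero: "\<iota> \<zero> = \<zero>\<^bsub>S\<^esub>"
  using ring_hom_zero[OF hom R.ring_axioms S.ring_axioms] .

lemma \<pi>_zero: "\<pi> \<zero>\<^bsub>S\<^esub> = \<zero>"
  using \<pi>_smult[of \<zero> "\<one>\<^bsub>S\<^esub>"] by (simp add: \<iota>_zero \<pi>_one)

lemma comp_in_fvec: "v \<in> fvec R d \<Longrightarrow> \<iota> \<circ> v \<in> fvec S d"
  unfolding fvec_def by (simp add: \<iota>_closed \<iota>_zero)

lemma comp_in_fspan:
  assumes T: "T \<subseteq> fvec R d" and "b \<in> fspan R d T"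
  shows "\<iota> \<circ> b \<in> fspan S d ((\<circ>) \<iota> ` T)"
  using assms(2)
proof induction
  case span_zero
  have "\<iota> \<circ> fzero R = fzero S" by (auto simp: fzero_def \<iota>_zero)
  then show ?case by (simp add: fspan.span_zero)
next
  case (span_base v)
  then show ?case by (auto intro: fspan.span_base)
next
  case (span_add v w)
  have "v \<in> fvec R d" "w \<in> fvec R d" using span_add R.fspan_subset_fvec[OF T] by auto
  then have "\<iota> \<circ> fadd R v w = fadd S (\<iota> \<circ> v) (\<iota> \<circ> w)"
    using R.fvecD by (auto simp: fadd_def ring_hom_add[OF hom])
  then show ?case using fspan.span_add[OF span_add.IH] by (simp only:)
next
  case (span_smult c v)
  have "v \<in> fvec R d" using span_smult R.fspan_subset_fvec[OF T] by auto
  then have "\<iota> \<circ> fsmult R c v = fsmult S (\<iota> c) (\<iota> \<circ> v)"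
    using R.fvecD span_smult by (auto simp: fsmult_def ring_hom_mult[OF hom])
  then show ?case using fspan.span_smult[OF \<iota>_closed[OF span_smult.hyps(1)] span_smult.IH] by (simp only:)
qed

text \<open>The scalar \<open>c\<close> makes the set of vectors all of whose \<open>S\<close>-multiples retract into the
  \<open>R\<close>-span closed under multiplication by \<open>S\<close>.\<close>

lemma retract_in_fspan:
  assumes T: "T \<subseteq> fvec R d" and "x \<in> fspan S d ((\<circ>) \<iota> ` T)" and "c \<in> carrier S"
  shows "(\<lambda>i. \<pi> (c \<otimes>\<^bsub>S\<^esub> x i)) \<in> fspan R d T"
  using assms(2,3)
proof (induction arbitrary: c)
  have T': "(\<circ>) \<iota> ` T \<subseteq> fvec S d" using T comp_in_fvec by blast
  have car: "y i \<in> carrier S" if "y \<in> fspan S d ((\<circ>) \<iota> ` T)" for y i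
    using S.fspan_subset_fvec[OF T'] that S.fvecD by blast
  {
    case span_zero
    then have "(\<lambda>i. \<pi> (c \<otimes>\<^bsub>S\<^esub> fzero S i)) = fzero R" by (simp add: fzero_def \<pi>_zero)
    then show ?case by (simp add: fspan.span_zero)
  next
    case (span_base v)
    then obtain t where t: "t \<in> T" "v = \<iota> \<circ> t" by blast
    have tc: "t i \<in> carrier R" for i using t T R.fvecD by blast
    \<comment> \<open>The entries of a generator come from \<open>R\<close>, so they can be pulled
      out of \<open>\<pi>\<close>, leaving a multiple of \<open>t\<close> by the single scalar
      \<open>\<pi> c\<close>.\<close>
    have "\<pi> (c \<otimes>\<^bsub>S\<^esub> v i) = \<pi> c \<otimes> t i" for i
    proof -
      have "\<pi> (c \<otimes>\<^bsub>S\<^esub> v i) = \<pi> (\<iota> (t i) \<otimes>\<^bsub>S\<^esub> c)"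
        using span_base(2) \<iota>_closed[OF tc[of i]] by (simp add: t S.m_comm)
      also have "\<dots> = \<pi> c \<otimes> t i"
        using span_base(2) tc[of i] by (simp add: \<pi>_smult \<pi>_closed R.m_comm)
      finally show ?thesis .
    qed
    then have "(\<lambda>i. \<pi> (c \<otimes>\<^bsub>S\<^esub> v i)) = fsmult R (\<pi> c) t" by (simp add: fsmult_def)
    then show ?case using t(1) span_base(2) by (simp add: fspan.span_smult fspan.span_base \<pi>_closed)
  next
    case (span_add v w)
    then have "(\<lambda>i. \<pi> (c \<otimes>\<^bsub>S\<^esub> fadd S v w i))
        = fadd R (\<lambda>i. \<pi> (c \<otimes>\<^bsub>S\<^esub> v i)) (\<lambda>i. \<pi> (c \<otimes>\<^bsub>S\<^esub> w i))"
      using car by (simp add: fadd_def S.r_distr \<pi>_add)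
    then show ?case using span_add by (simp add: fspan.span_add)
  next
    case (span_smult a v)
    then have "(\<lambda>i. \<pi> (c \<otimes>\<^bsub>S\<^esub> fsmult S a v i)) = (\<lambda>i. \<pi> ((c \<otimes>\<^bsub>S\<^esub> a) \<otimes>\<^bsub>S\<^esub> v i))"
      using car by (simp add: fsmult_def S.m_assoc)
    then show ?case using span_smult by simp
  }
qed

text \<open>Retracting with the scalar \<open>c\<close> equal to one returns \<open>b\<close>
  itself.\<close>

lemma in_fspan_of_comp:
  assumes T: "T \<subseteq> fvec R d" and b: "b \<in> fvec R d" and "\<iota> \<circ> b \<in> fspan S d ((\<circ>) \<iota> ` T)"
  shows "b \<in> fspan R d T"
proof -
  have "\<pi> (\<one>\<^bsub>S\<^esub> \<otimes>\<^bsub>S\<^esub> (\<iota> \<circ> b) i) = b i" for i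
    using \<pi>_smult[of "b i" "\<one>\<^bsub>S\<^esub>"] R.fvecD[OF b, of i] by (simp add: \<iota>_closed \<pi>_one)
  then show ?thesis using retract_in_fspan[OF T assms(3), of "\<one>\<^bsub>S\<^esub>"] by simp
qed

text \<open>Generators are inserted over both fields in parallel: \<open>b\<close> enlarges the span
  over \<open>R\<close> exactly when its image enlarges the span over \<open>S\<close>, so both
  exponents grow together.\<close>

lemma card_fspan_comp:
  assumes "finite T" "T \<subseteq> fvec R d"
  shows "\<exists>n. card (fspan R d T) = card (carrier R) ^ n \<and>
    card (fspan S d ((\<circ>) \<iota> ` T)) = card (carrier S) ^ n"
  using assms
proof (induction T)
  case empty
  then show ?case
    by (intro exI[of _ 0]) (simp add: R.card_fspan_empty S.card_fspan_empty)
next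
  case (insert b T)
  then have b: "b \<in> fvec R d" and T: "T \<subseteq> fvec R d" and T': "(\<circ>) \<iota> ` T \<subseteq> fvec S d"
    using comp_in_fvec by auto
  obtain n where n: "card (fspan R d T) = card (carrier R) ^ n"
      "card (fspan S d ((\<circ>) \<iota> ` T)) = card (carrier S) ^ n"
    using insert.IH T by blast
  show ?case
  proof (cases "b \<in> fspan R d T")
    case True
    then show ?thesis
      using n fspan_insert_redundant[OF True] fspan_insert_redundant[OF comp_in_fspan[OF T True]]
      by (intro exI[of _ n]) (simp only: image_insert)
  next
    case False
    then have "\<iota> \<circ> b \<notin> fspan S d ((\<circ>) \<iota> ` T)" using in_fspan_of_comp[OF T b] by blast
    then show ?thesis
      using n R.card_fspan_insert[OF T b False] S.card_fspan_insert[OF T' comp_in_fvec[OF b]]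
      by (intro exI[of _ "Suc n"]) (simp only: image_insert power_Suc simp_thms)
  qed
qed

lemma span_rep_base_change:
  assumes rep: "span_rep R E h" shows "span_rep S E h"
proof -
  obtain d T n where T: "\<And>e. e \<in> E \<Longrightarrow> T e \<subseteq> fvec R d"
    and h: "\<And>A. A \<subseteq> E \<Longrightarrow> h A = real (n A)"
    and card: "\<And>A. A \<subseteq> E \<Longrightarrow> card (fspan R d (\<Union>e\<in>A. T e)) = card (carrier R) ^ n A"
    by (rule span_repE[OF rep]) (rule that; simp)
  show ?thesis
  proof (rule span_repI)
    show "(\<circ>) \<iota> ` T e \<subseteq> fvec S d" if "e \<in> E" for e using T[OF that] comp_in_fvec by blast
    show "h A = real (n A)" if "A \<subseteq> E" for A using h[OF that] .
  next
    fix A assume A: "A \<subseteq> E"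
    have sub: "(\<Union>e\<in>A. T e) \<subseteq> fvec R d" using T A by blast
    then have "finite (\<Union>e\<in>A. T e)" using R.finite_fvec finite_subset by blast
    from card_fspan_comp[OF this sub] obtain m where m:
      "card (fspan R d (\<Union>e\<in>A. T e)) = card (carrier R) ^ m"
      "card (fspan S d ((\<circ>) \<iota> ` (\<Union>e\<in>A. T e))) = card (carrier S) ^ m" by blast
    have "m = n A" using m(1) card[OF A] R.q_ge_2 by (simp add: power_inject_exp)
    then show "card (fspan S d (\<Union>e\<in>A. (\<circ>) \<iota> ` T e)) = card (carrier S) ^ n A"
      using m(2) by (simp add: image_UN)
  qed
qed

end

section \<open>Quadratic extensions\<close>

text \<open>The pair \<open>(a, b)\<close> stands for \<open>a + b t\<close>, where \<open>t\<^sup>2 = t + c\<close>.\<close>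

definition quad_ext :: "('a, 'b) ring_scheme \<Rightarrow> 'a \<Rightarrow> ('a \<times> 'a) ring" where
  "quad_ext R c = \<lparr>carrier = carrier R \<times> carrier R,
     mult = (\<lambda>x y. (fst x \<otimes>\<^bsub>R\<^esub> fst y \<oplus>\<^bsub>R\<^esub> c \<otimes>\<^bsub>R\<^esub> (snd x \<otimes>\<^bsub>R\<^esub> snd y),
       fst x \<otimes>\<^bsub>R\<^esub> snd y \<oplus>\<^bsub>R\<^esub> snd x \<otimes>\<^bsub>R\<^esub> fst y \<oplus>\<^bsub>R\<^esub> snd x \<otimes>\<^bsub>R\<^esub> snd y)),
     one = (\<one>\<^bsub>R\<^esub>, \<zero>\<^bsub>R\<^esub>), zero = (\<zero>\<^bsub>R\<^esub>, \<zero>\<^bsub>R\<^esub>),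
     add = (\<lambda>x y. (fst x \<oplus>\<^bsub>R\<^esub> fst y, snd x \<oplus>\<^bsub>R\<^esub> snd y))\<rparr>"

lemma (in cring) quad_ext_cring:
  assumes c: "c \<in> carrier R" shows "cring (quad_ext R c)"
proof (rule cringI)
  show "abelian_group (quad_ext R c)"
  proof (rule abelian_groupI)
    fix x assume "x \<in> carrier (quad_ext R c)"
    then show "\<exists>y\<in>carrier (quad_ext R c). y \<oplus>\<^bsub>quad_ext R c\<^esub> x = \<zero>\<^bsub>quad_ext R c\<^esub>"
      by (intro bexI[of _ "(\<ominus> fst x, \<ominus> snd x)"]) (auto simp: quad_ext_def l_neg)
  qed (auto simp: quad_ext_def a_ac)
  show "comm_monoid (quad_ext R c)"
  proof (rule comm_monoidI)
    fix x y z
    assume "x \<in> carrier (quad_ext R c)" "y \<in> carrier (quad_ext R c)" "z \<in> carrier (quad_ext R c)"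
    then obtain a b a' b' a'' b'' where *: "x = (a, b)" "y = (a', b')" "z = (a'', b'')"
      "a \<in> carrier R" "b \<in> carrier R" "a' \<in> carrier R" "b' \<in> carrier R" "a'' \<in> carrier R" "b'' \<in> carrier R"
      by (cases x, cases y, cases z) (auto simp: quad_ext_def)
    \<comment> \<open>Associativity, first in the constant term and then in the coefficient of
      \<open>t\<close>.\<close>
    have "(a \<otimes> a' \<oplus> c \<otimes> (b \<otimes> b')) \<otimes> a'' \<oplus> c \<otimes> ((a \<otimes> b' \<oplus> b \<otimes> a' \<oplus> b \<otimes> b') \<otimes> b'')
      = a \<otimes> (a' \<otimes> a'' \<oplus> c \<otimes> (b' \<otimes> b'')) \<oplus> c \<otimes> (b \<otimes> (a' \<otimes> b'' \<oplus> b' \<otimes> a'' \<oplus> b' \<otimes> b''))"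
      using *(4-9) c by algebra
    moreover have "(a \<otimes> a' \<oplus> c \<otimes> (b \<otimes> b')) \<otimes> b'' \<oplus> (a \<otimes> b' \<oplus> b \<otimes> a' \<oplus> b \<otimes> b') \<otimes> a''
        \<oplus> (a \<otimes> b' \<oplus> b \<otimes> a' \<oplus> b \<otimes> b') \<otimes> b''
      = a \<otimes> (a' \<otimes> b'' \<oplus> b' \<otimes> a'' \<oplus> b' \<otimes> b'') \<oplus> b \<otimes> (a' \<otimes> a'' \<oplus> c \<otimes> (b' \<otimes> b''))
        \<oplus> b \<otimes> (a' \<otimes> b'' \<oplus> b' \<otimes> a'' \<oplus> b' \<otimes> b'')"
      using *(4-9) c by algebra
    ultimately show "x \<otimes>\<^bsub>quad_ext R c\<^esub> y \<otimes>\<^bsub>quad_ext R c\<^esub> z = x \<otimes>\<^bsub>quad_ext R c\<^esub> (y \<otimes>\<^bsub>quad_ext R c\<^esub> z)"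
      by (simp add: quad_ext_def *)
  qed (use c in \<open>auto simp: quad_ext_def m_ac a_ac\<close>)
  fix x y z
  assume "x \<in> carrier (quad_ext R c)" "y \<in> carrier (quad_ext R c)" "z \<in> carrier (quad_ext R c)"
  then obtain a b a' b' a'' b'' where *: "x = (a, b)" "y = (a', b')" "z = (a'', b'')"
    "a \<in> carrier R" "b \<in> carrier R" "a' \<in> carrier R" "b' \<in> carrier R" "a'' \<in> carrier R" "b'' \<in> carrier R"
    by (cases x, cases y, cases z) (auto simp: quad_ext_def)
  have "(a \<oplus> a') \<otimes> a'' \<oplus> c \<otimes> ((b \<oplus> b') \<otimes> b'')
      = (a \<otimes> a'' \<oplus> c \<otimes> (b \<otimes> b'')) \<oplus> (a' \<otimes> a'' \<oplus> c \<otimes> (b' \<otimes> b''))"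
    using *(4-9) c by algebra
  moreover have "(a \<oplus> a') \<otimes> b'' \<oplus> (b \<oplus> b') \<otimes> a'' \<oplus> (b \<oplus> b') \<otimes> b''
      = (a \<otimes> b'' \<oplus> b \<otimes> a'' \<oplus> b \<otimes> b'') \<oplus> (a' \<otimes> b'' \<oplus> b' \<otimes> a'' \<oplus> b' \<otimes> b'')"
    using *(4-9) c by algebra
  ultimately show "(x \<oplus>\<^bsub>quad_ext R c\<^esub> y) \<otimes>\<^bsub>quad_ext R c\<^esub> z
      = x \<otimes>\<^bsub>quad_ext R c\<^esub> z \<oplus>\<^bsub>quad_ext R c\<^esub> y \<otimes>\<^bsub>quad_ext R c\<^esub> z"
    by (simp add: quad_ext_def *)
qed

text \<open>The inverse is the conjugate divided by the norm. The roots of the quadratic for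
  \<open>t\<close> sum to one, so conjugation sends \<open>t\<close> to \<open>1 - t\<close>, and
  \<open>a + b t\<close> to \<open>(a + b) - b t\<close>.\<close>

lemma (in field) quad_ext_field:
  assumes c: "c \<in> carrier R" and no_root: "\<And>x. x \<in> carrier R \<Longrightarrow> x \<otimes> x \<ominus> x \<noteq> c"
  shows "field (quad_ext R c)"
proof -
  interpret Q: cring "quad_ext R c" using quad_ext_cring[OF c] .
  show ?thesis
  proof (rule Q.field_intro2)
    show "\<zero>\<^bsub>quad_ext R c\<^esub> \<noteq> \<one>\<^bsub>quad_ext R c\<^esub>" by (simp add: quad_ext_def)
  next
    fix x assume x: "x \<in> carrier (quad_ext R c) - {\<zero>\<^bsub>quad_ext R c\<^esub>}"
    then obtain a b where ab: "x = (a, b)" "a \<in> carrier R" "b \<in> carrier R" "a \<noteq> \<zero> \<or> b \<noteq> \<zero>"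
      by (cases x) (auto simp: quad_ext_def)
    \<comment> \<open>The norm, that is, the product of \<open>a + b t\<close> with its
      conjugate.\<close>
    define N where "N = a \<otimes> a \<oplus> a \<otimes> b \<ominus> c \<otimes> (b \<otimes> b)"
    have N: "N \<in> carrier R" using ab c by (simp add: N_def)
    have "N \<noteq> \<zero>"
    proof
      assume N0: "N = \<zero>"
      show False
      proof (cases "b = \<zero>")
        case True
        then have "a \<otimes> a = \<zero>" using N0 ab c by (simp add: N_def a_minus_def)
        then show False using True ab integral by blast
      next
        case False
        then have b': "inv b \<in> carrier R" "b \<otimes> inv b = \<one>" using ab by (auto simp: field_Units)
        \<comment> \<open>If the norm vanished with \<open>b\<close> nonzero, \<open>- a / b\<close>
          would be a solution excluded by \<open>no_root\<close>.\<close>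
        define y where "y = \<ominus> (a \<otimes> inv b)"
        have y: "y \<in> carrier R" using ab b' by (simp add: y_def)
        \<comment> \<open>A polynomial identity in which \<open>inv b\<close> is treated as a free
          variable; the correction terms carry the factor
          \<open>\<one> \<ominus> b \<otimes> inv b\<close>, which is zero.\<close>
        have "y \<otimes> y \<ominus> y \<ominus> c = inv b \<otimes> inv b \<otimes> N
            \<oplus> (a \<otimes> inv b \<otimes> (\<one> \<ominus> b \<otimes> inv b) \<ominus> c \<otimes> (\<one> \<ominus> b \<otimes> inv b) \<otimes> (\<one> \<oplus> b \<otimes> inv b))"
          unfolding y_def N_def using ab(2,3) b'(1) c by algebra
        also have "\<dots> = \<zero>" using N0 ab b' c by (simp add: a_minus_def r_neg)
        finally have "y \<otimes> y \<ominus> y \<ominus> c = \<zero>" .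
        moreover have "y \<otimes> y \<ominus> y = (y \<otimes> y \<ominus> y \<ominus> c) \<oplus> c" using y c by algebra
        ultimately have "y \<otimes> y \<ominus> y = c" using c by simp
        then show False using no_root[OF y] by blast
      qed
    qed
    then obtain M where M: "M \<in> carrier R" "N \<otimes> M = \<one>" using N Units_r_inv_ex[of N] by (auto simp: field_Units)
    \<comment> \<open>The conjugate of \<open>x\<close> times the inverse \<open>M\<close> of its
      norm.\<close>
    let ?y = "((a \<oplus> b) \<otimes> M, \<ominus> b \<otimes> M)"
    have "a \<otimes> ((a \<oplus> b) \<otimes> M) \<oplus> c \<otimes> (b \<otimes> (\<ominus> b \<otimes> M)) = N \<otimes> M"
      unfolding N_def using ab(2,3) M(1) c by algebra
    moreover have "a \<otimes> (\<ominus> b \<otimes> M) \<oplus> b \<otimes> ((a \<oplus> b) \<otimes> M) \<oplus> b \<otimes> (\<ominus> b \<otimes> M) = \<zero>"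
      using ab(2,3) M(1) c by algebra
    ultimately have prod: "x \<otimes>\<^bsub>quad_ext R c\<^esub> ?y = \<one>\<^bsub>quad_ext R c\<^esub>"
      using M(2) by (simp add: quad_ext_def ab(1))
    have y: "?y \<in> carrier (quad_ext R c)" using ab M by (simp add: quad_ext_def)
    then show "x \<in> Units (quad_ext R c)"
      using x prod Q.m_comm[of x ?y] unfolding Units_def by auto
  qed
qed

section \<open>Existence of arbitrarily large extensions\<close>

context finite_field
begin

text \<open>On a finite field \<open>x \<mapsto> x\<^sup>2 - x\<close> takes the value \<open>0\<close> twice, hence misses some value.\<close>

lemma obtain_no_root:
  obtains c where "c \<in> carrier R" "\<And>x. x \<in> carrier R \<Longrightarrow> x \<otimes> x \<ominus> x \<noteq> c"
proof -
  let ?f = "\<lambda>x. x \<otimes> x \<ominus> x"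
  have "?f \<zero> = ?f \<one>" by (simp add: a_minus_def r_neg)
  then have "\<not> inj_on ?f (carrier R)" using inj_onD[of ?f "carrier R" \<zero> \<one>] by auto
  then have "?f ` carrier R \<noteq> carrier R"
    using finite_carrier eq_card_imp_inj_on by metis
  moreover have "?f ` carrier R \<subseteq> carrier R" by auto
  ultimately show thesis using that by blast
qed

end

text \<open>The quadratic extension lives on pairs; it is transported along
  \<open>prod_encode\<close> so that its carrier again consists of natural numbers and the
  construction can be iterated.\<close>

lemma obtain_larger_retracted_extension:
  fixes R :: "nat ring"
  assumes "finite_field R"
  obtains S :: "nat ring" and \<iota> \<pi> where "retracted_extension R S \<iota> \<pi>"
    "card (carrier R) < card (carrier S)"
proof -
  interpret finite_field R by fact
  obtain c where c: "c \<in> carrier R" and no_root: "\<And>x. x \<in> carrier R \<Longrightarrow> x \<otimes>\<^bsub>R\<^esub> x \<ominus>\<^bsub>R\<^esub> x \<noteq> c"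
    using obtain_no_root by metis
  let ?Q = "quad_ext R c"
  interpret Q: field ?Q using quad_ext_field[OF c no_root] .
  define S where "S = image_ring prod_encode ?Q"
  have inj: "inj_on prod_encode (carrier ?Q)" by (rule inj_prod_encode)
  have carS: "carrier S = prod_encode ` (carrier R \<times> carrier R)"
    by (simp add: S_def image_ring_carrier quad_ext_def)
  interpret S: finite_field S
    unfolding finite_field_def finite_field_axioms_def
    using Q.inj_imp_image_ring_is_field[OF inj] finite_carrier carS by (simp add: S_def)
  have enc: "prod_encode \<in> ring_hom ?Q S"
    using inj_imp_image_ring_iso[OF inj] by (simp add: S_def ring_iso_def)
  define dec where "dec = Hilbert_Choice.inv prod_encode"
  have dec: "dec \<in> ring_hom S ?Q"
    using inj_imp_image_ring_inv_iso[of prod_encode ?Q] inj_prod_encode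
    by (simp add: S_def dec_def ring_iso_def)
  have dec_enc: "dec (prod_encode x) = x" for x
    unfolding dec_def by (rule inv_f_f[OF inj_prod_encode])
  \<comment> \<open>Constants are embedded as \<open>a + 0 t\<close>, and \<open>\<pi>\<close> takes
    the constant term; multiplying by a constant acts coordinatewise, which gives linearity over
    \<open>R\<close>.\<close>
  define \<iota> where "\<iota> a = prod_encode (a, \<zero>\<^bsub>R\<^esub>)" for a
  define \<pi> where "\<pi> x = fst (dec x)" for x
  have \<iota>_hom: "\<iota> \<in> ring_hom R S"
  proof -
    have "(\<lambda>a. (a, \<zero>\<^bsub>R\<^esub>)) \<in> ring_hom R ?Q"
      using c by (intro ring_hom_memI) (auto simp: quad_ext_def)
    from ring_hom_trans[OF this enc] show ?thesis by (simp add: \<iota>_def[abs_def] comp_def)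
  qed
  have dec_car: "fst (dec x) \<in> carrier R" "snd (dec x) \<in> carrier R" if "x \<in> carrier S" for x
    using ring_hom_closed[OF dec that] by (auto simp: quad_ext_def)
  have "retracted_extension R S \<iota> \<pi>"
  proof (unfold_locales, goal_cases)
    case 1 then show ?case by (rule \<iota>_hom)
  next
    case (2 x) then show ?case by (simp add: \<pi>_def dec_car)
  next
    case (3 x y)
    then show ?case using ring_hom_add[OF dec 3] by (simp add: \<pi>_def quad_ext_def)
  next
    case (4 a x)
    then show ?case
      using ring_hom_mult[OF dec ring_hom_closed[OF \<iota>_hom 4(1)] 4(2)] dec_car[OF 4(2)] c
      by (simp add: \<pi>_def \<iota>_def dec_enc quad_ext_def)
  next
    case 5
    then show ?case using ring_hom_one[OF dec] by (simp add: \<pi>_def quad_ext_def)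
  qed
  moreover have "card (carrier S) = q * q"
    using card_image[OF inj] by (simp add: carS quad_ext_def card_cartesian_product)
  then have "q < card (carrier S)" using q_ge_2 by simp
  ultimately show thesis using that by blast
qed

text \<open>Each extension is strictly larger, so iterating passes any bound \<open>N\<close>, while
  base change keeps the ranks.\<close>

lemma obtain_large_span_rep:
  fixes R :: "nat ring"
  assumes "finite_field R" "span_rep R E h"
  obtains S :: "nat ring" where "finite_field S" "span_rep S E h" "N < card (carrier S)"
proof -
  have "\<exists>S :: nat ring. finite_field S \<and> span_rep S E h \<and> N < card (carrier S)"
  proof (induction N)
    case 0
    then show ?case using assms finite_field.q_ge_2[OF assms(1)] by (intro exI[of _ R]) auto
  next
    case (Suc N)
    then obtain S :: "nat ring" where S: "finite_field S" "span_rep S E h" "N < card (carrier S)"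
      by blast
    obtain S' :: "nat ring" and \<iota> \<pi> where S': "retracted_extension S S' \<iota> \<pi>"
      "card (carrier S) < card (carrier S')"
      using obtain_larger_retracted_extension[OF S(1)] by blast
    have "finite_field S'" using S'(1) by (simp add: retracted_extension_def)
    moreover have "span_rep S' E h" using retracted_extension.span_rep_base_change[OF S'(1) S(2)] .
    ultimately show ?case using S(3) S'(2) by (intro exI[of _ S']) auto
  qed
  then show thesis using that by blast
qed

section \<open>Truncation\<close>

lemma representable_iff_span_rep:
  "representable E h \<longleftrightarrow> (\<exists>R :: nat ring. finite_field R \<and> span_rep R E h)"
  by (auto simp: representable_def q_representable_iff_span_rep)

text \<open>The field is first enlarged beyond \<open>2 ^ card E\<close>; this is harmless because
  \<open>representable\<close> leaves the size of the field open.\<close>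

lemma representable_truncate:
  assumes "finite E" "representable E h" "real k \<le> h E"
  shows "representable E (\<lambda>A. min (h A) (h E - real k))"
proof -
  obtain R :: "nat ring" where "finite_field R" "span_rep R E h"
    using assms(2) by (auto simp: representable_iff_span_rep)
  then obtain S :: "nat ring" where S: "finite_field S" "span_rep S E h" "2 ^ card E < card (carrier S)"
    using obtain_large_span_rep by metis
  then show ?thesis
    using finite_field.span_rep_truncate[OF S(1) assms(1) S(3,2) assms(3)]
    by (auto simp: representable_iff_span_rep)
qed

lemma representable_multiple:
  assumes "representable E h" shows "representable E (\<lambda>A. real (Suc m) * h A)"
proof -
  obtain R :: "nat ring" where R: "finite_field R" "span_rep R E h"
    using assms by (auto simp: representable_iff_span_rep)
  interpret finite_field R by fact
  show ?thesis
    using span_rep_multiple[OF R(2)] R(1) by (auto simp: representable_iff_span_rep)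
qed

lemma floor_multiple_div_tendsto:
  fixes x :: real
  shows "(\<lambda>i. real_of_int \<lfloor>real (Suc i) * x\<rfloor> / real (Suc i)) \<longlonglongrightarrow> x"
proof (rule tendsto_sandwich)
  show "\<forall>\<^sub>F i in sequentially. x - 1 / real (Suc i) \<le> real_of_int \<lfloor>real (Suc i) * x\<rfloor> / real (Suc i)"
  proof (rule always_eventually, rule allI)
    fix i
    have "real (Suc i) * x - 1 \<le> real_of_int \<lfloor>real (Suc i) * x\<rfloor>" by linarith
    then have "(real (Suc i) * x - 1) / real (Suc i) \<le> real_of_int \<lfloor>real (Suc i) * x\<rfloor> / real (Suc i)"
      by (rule divide_right_mono) simp
    then show "x - 1 / real (Suc i) \<le> real_of_int \<lfloor>real (Suc i) * x\<rfloor> / real (Suc i)"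
      by (simp add: diff_divide_distrib)
  qed
  show "\<forall>\<^sub>F i in sequentially. real_of_int \<lfloor>real (Suc i) * x\<rfloor> / real (Suc i) \<le> x"
  proof (rule always_eventually, rule allI)
    fix i
    have "real_of_int \<lfloor>real (Suc i) * x\<rfloor> \<le> real (Suc i) * x" by linarith
    then show "real_of_int \<lfloor>real (Suc i) * x\<rfloor> / real (Suc i) \<le> x"
      by (simp only: pos_divide_le_eq of_nat_0_less_iff zero_less_Suc mult.commute)
  qed
  have "(\<lambda>i. 1 / real (Suc i)) \<longlonglongrightarrow> 0"
    using LIMSEQ_inverse_real_of_nat by (simp add: inverse_eq_divide)
  from tendsto_diff[OF tendsto_const this]
  show "(\<lambda>i. x - 1 / real (Suc i)) \<longlonglongrightarrow> x" by simp
qed simp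

lemma almost_representable_truncate:
  assumes E: "finite E" and h: "representable E h" and "0 \<le> \<epsilon>" "\<epsilon> \<le> h E"
  shows "almost_representable E (\<lambda>A. min (h A) (h E - \<epsilon>))"
proof -
  \<comment> \<open>The integer closest from below to the truncation due for the multiple
    \<open>Suc i\<close> of \<open>h\<close>. It is nonnegative because \<open>\<epsilon>\<close>
    is, so \<open>nat\<close> loses nothing; \<open>Suc i\<close> keeps the scaling factor
    positive.\<close>
  define k where "k i = nat \<lfloor>real (Suc i) * \<epsilon>\<rfloor>" for i
  have k: "real (k i) = real_of_int \<lfloor>real (Suc i) * \<epsilon>\<rfloor>" for i
    using assms(3) by (simp add: k_def)
  define g where "g i A = min (real (Suc i) * h A) (real (Suc i) * h E - real (k i))" for i A
  have "representable E (g i)" for i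
  proof -
    have "real (k i) \<le> real (Suc i) * \<epsilon>" unfolding k by linarith
    also have "\<dots> \<le> real (Suc i) * h E" using assms(4) by (intro mult_left_mono) auto
    finally show ?thesis
      using representable_truncate[OF E representable_multiple[OF h, of i], of "k i"]
      unfolding g_def by blast
  qed
  moreover have "(\<lambda>i. 1 / real (Suc i) * g i A) \<longlonglongrightarrow> min (h A) (h E - \<epsilon>)" for A
  proof -
    \<comment> \<open>After rescaling only the truncation level depends on \<open>i\<close>, and it
      converges to \<open>h E - \<epsilon>\<close>.\<close>
    have "1 / real (Suc i) * g i A = min (h A) (h E - real_of_int \<lfloor>real (Suc i) * \<epsilon>\<rfloor> / real (Suc i))" for i
      unfolding g_def k by (simp add: min_mult_distrib_left min_divide_distrib_right diff_divide_distrib)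
    then show ?thesis
      by (simp only:) (intro tendsto_min tendsto_const tendsto_diff floor_multiple_div_tendsto)
  qed
  moreover have "0 < 1 / real (Suc i)" for i by simp
  ultimately show ?thesis
    unfolding almost_representable_def
    by (intro exI[of _ g] exI[of _ "\<lambda>i. 1 / real (Suc i)"] conjI allI impI)
qed

theorem theorem2:
  fixes E :: "'e set" and h :: "'e set \<Rightarrow> real" and \<epsilon> :: real
  assumes "polymatroid E h"
    and "representable E h"
    and "0 \<le> \<epsilon>" and "\<epsilon> \<le> h E"
  shows "almost_representable E (\<lambda>A. min (h A) (h E - \<epsilon>)) \<and>
         (\<epsilon> \<in> \<int> \<longrightarrow> representable E (\<lambda>A. min (h A) (h E - \<epsilon>)))"
proof (intro conjI impI)
  have E: "finite E" using assms(1) unfolding polymatroid_def by (rule conjunct1)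
  show "almost_representable E (\<lambda>A. min (h A) (h E - \<epsilon>))"
    using almost_representable_truncate[OF E assms(2-4)] .
  assume "\<epsilon> \<in> \<int>"
  then obtain z where "\<epsilon> = of_int z" by (elim Ints_cases)
  \<comment> \<open>A nonnegative integer is a natural number, so the exact truncation applies
    without passing to a limit.\<close>
  then have "\<epsilon> = real (nat z)" using assms(3) by simp
  then show "representable E (\<lambda>A. min (h A) (h E - \<epsilon>))"
    using representable_truncate[OF E assms(2), of "nat z"] assms(4) by simp
qed

end
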